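(* There does not exist a rational function $R(p,q)$ of two variables such that for all odd and coprime positive integers $p,q$, $$R(p,q)=\sigma_{ord}(T_{p,q}),$$ where $\sigma_{ord}(T_{p,q})$ denotes the ordinary signature of the torus knot $T_{p,q}$.
   Context: A rational function of two variables is a quotient of two polynomials in two variables with real coefficients (denominator not the zero polynomial). For a knot $K\subset S^3$ with Seifert matrix $S$ and $z\in S^1\subset\mathbb{C}$, $z\neq 1$, the Tristram--Levine signature $\sigma(z)$ is the signature of the hermitian form $(1-z)S+(1-\bar z)S^T$; it is independent of the choice of Seifert matrix. The ordinary signature is $\sigma_{ord}=\sigma(-1)$. For the torus knot $T_{p,q}$, $\gcd(p,q)=1$, the following known formula (Litherland) holds, which also fixes the sign convention. Let $\Sigma=\{\frac kp+\frac lq : 1\le k\le p-1,\ 1\le l\le q-1\}$. Then $$\sigma_{ord}(T_{p,q})=|\Sigma\setminus(1/2,3/2)|-|\Sigma\cap(1/2,3/2)|,$$ where $|\cdot|$ denotes cardinality. *)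

theory Defs
  imports
    Complex_Main
    "HOL-Computational_Algebra.Polynomial"
    "Jordan_Normal_Form.VS_Connect"
    "Jordan_Normal_Form.Conjugate"
begin

section \<open>Rational functions of two variables\<close>

text \<open>Polynomials in two variables are elements of \<open>\<real>[x][y]\<close>: the outer polynomial variable is
  \<open>y\<close>, and the coefficients are polynomials in \<open>x\<close>.\<close>

definition eval2 :: "real poly poly \<Rightarrow> real \<Rightarrow> real \<Rightarrow> real" where
  "eval2 P x y = poly (poly P [:y:]) x"

text \<open>The quotient \<open>N / D\<close> is a rational function (\<open>D \<noteq> 0\<close> as a polynomial) that is defined at
  \<open>(x, y)\<close> and has the value \<open>r\<close> there. Since division by \<open>0\<close> is total in HOL, being defined has
  to be demanded explicitly.\<close>

definition ratfun_value :: "real poly poly \<Rightarrow> real poly poly \<Rightarrow> real \<Rightarrow> real \<Rightarrow> real \<Rightarrow> bool" where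
  "ratfun_value N D x y r \<longleftrightarrow> eval2 D x y \<noteq> 0 \<and> eval2 N x y / eval2 D x y = r"


section \<open>Signature of a hermitian form\<close>

text \<open>The positive index of inertia of the hermitian form \<open>v \<mapsto> v\<^sup>* A v\<close>: the largest dimension of a
  subspace on which the form is positive definite.\<close>

definition positive_index :: "complex mat \<Rightarrow> nat" where
  "positive_index A = Max {vectorspace.dim class_ring
        (module_vec TYPE(complex) (dim_row A)\<lparr>carrier := W\<rparr>) | W.
      subspace class_ring W (module_vec TYPE(complex) (dim_row A)) \<and>
      (\<forall>v\<in>W. v \<noteq> 0\<^sub>v (dim_row A) \<longrightarrow> Re ((A *\<^sub>v v) \<bullet>c v) > 0)}"

definition hermitian_signature :: "complex mat \<Rightarrow> int" where
  "hermitian_signature A = int (positive_index A) - int (positive_index (- A))"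


section \<open>Knots as closed braids and their Seifert matrices\<close>

text \<open>A braid word is a list of nonzero integers; the entry \<open>i > 0\<close> stands for the standard generator
  \<open>\<sigma>\<^sub>i\<close> and \<open>-i\<close> for its inverse. The closure of a positive generator is a positive (right-handed)
  crossing, so \<open>[1, 1, 1]\<close> closes up to the right-handed trefoil. By Alexander's theorem every knot
  is the closure of a braid word.

  Seifert's algorithm applied to the closure of a word \<open>w\<close> in \<open>\<sigma>\<^sub>1, \<dots>, \<sigma>\<^sub>n\<^sub>-\<^sub>1\<close> gives \<open>n\<close> stacked
  discs, disc \<open>i\<close> and disc \<open>i + 1\<close> being joined by one half-twisted band for each occurrence of
  \<open>\<sigma>\<^sub>i\<^sup>\<plusminus>\<^sup>1\<close>. If the closure is a knot, this surface is connected, and a basis of its first homology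
  consists of the loops that run up through one band and down through the next band in the same
  column. Such a loop is recorded as the pair of positions \<open>(a, b)\<close> of its two bands in \<open>w\<close>.\<close>

definition seifert_loops :: "int list \<Rightarrow> (nat \<times> nat) list" where
  "seifert_loops w = filter
     (\<lambda>(a, b). a < b \<and> \<bar>w ! a\<bar> = \<bar>w ! b\<bar> \<and> (\<forall>c\<in>{a<..<b}. \<bar>w ! c\<bar> \<noteq> \<bar>w ! a\<bar>))
     (List.product [0..<length w] [0..<length w])"

text \<open>The linking number of one basis loop with the push-off of another one. Two distinct loops in
  the same column can only interact in a shared band (cases \<open>b = c\<close> and \<open>d = a\<close>), and loops in
  neighbouring columns only in the common disc, where they interact iff their bands interleave. A
  single half-twist of a positive band contributes \<open>-1/2\<close> to the self-linking.\<close>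

definition seifert_linking :: "int list \<Rightarrow> nat \<times> nat \<Rightarrow> nat \<times> nat \<Rightarrow> int" where
  "seifert_linking w = (\<lambda>(a, b) (c, d).
     if (a, b) = (c, d) then - ((sgn (w ! a) + sgn (w ! b)) div 2)
     else if b = c then (if w ! b > 0 then 1 else 0)
     else if d = a then (if w ! a < 0 then - 1 else 0)
     else if \<bar>w ! a\<bar> = \<bar>w ! c\<bar> + 1 then
       (if a < c \<and> c < b \<and> b < d then 1
        else if c < a \<and> a < d \<and> d < b then - 1
        else 0)
     else 0)"

definition seifert_matrix :: "int list \<Rightarrow> int mat" where
  "seifert_matrix w = mat (length (seifert_loops w)) (length (seifert_loops w))
     (\<lambda>(i, j). seifert_linking w (seifert_loops w ! i) (seifert_loops w ! j))"

definition tristram_levine_form :: "int mat \<Rightarrow> complex \<Rightarrow> complex mat" where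
  "tristram_levine_form S z =
     (1 - z) \<cdot>\<^sub>m map_mat of_int S + (1 - cnj z) \<cdot>\<^sub>m transpose_mat (map_mat of_int S)"

text \<open>The following is meant for \<open>w\<close> closing up to a knot and for \<open>z \<noteq> 1\<close> on the unit circle.\<close>

definition tristram_levine_signature :: "int list \<Rightarrow> complex \<Rightarrow> int" where
  "tristram_levine_signature w z =
     hermitian_signature (tristram_levine_form (seifert_matrix w) z)"

definition sigma_ord :: "int list \<Rightarrow> int" where
  "sigma_ord w = tristram_levine_signature w (- 1)"

text \<open>The torus knot \<open>T\<^sub>p\<^sub>,\<^sub>q\<close> is the closure of the braid \<open>(\<sigma>\<^sub>1 \<sigma>\<^sub>2 \<dots> \<sigma>\<^sub>p\<^sub>-\<^sub>1)\<^sup>q\<close> on \<open>p\<close> strands. With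
  these conventions the signature of \<open>T\<^sub>2\<^sub>,\<^sub>3\<close> is \<open>-2\<close>, in accordance with the number of
  \<open>k/p + l/q\<close> (\<open>0 < k < p\<close>, \<open>0 < l < q\<close>) outside the interval \<open>(1/2, 3/2)\<close> minus the number of
  those inside it.\<close>

definition torus_knot :: "nat \<Rightarrow> nat \<Rightarrow> int list" where
  "torus_knot p q = concat (replicate q (map int [1..<p]))"

end

theory Submission
  imports Defs
begin

text \<open>The knots \<open>T\<^sub>3\<^sub>,\<^sub>q\<close> alone rule out a rational function \<open>R\<close>. The Seifert matrix of \<open>T\<^sub>3\<^sub>,\<^sub>q\<close> has size
  \<open>2q - 2\<close>, so \<open>R(3, q)\<close> is an integer of absolute value at most \<open>2q - 2\<close> at the admissible \<open>q\<close>. A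
  rational function in one variable with integer values and linear growth along an arithmetic
  progression is a polynomial of degree at most one. The unknot \<open>T\<^sub>3\<^sub>,\<^sub>1\<close> has signature \<open>0\<close>, and the form
  of \<open>T\<^sub>3\<^sub>,\<^sub>5\<close> is the negative definite \<open>E\<^sub>8\<close> form of signature \<open>-8\<close>; hence \<open>R(3, q) = -2(q - 1)\<close>. Then
  the form of \<open>T\<^sub>3\<^sub>,\<^sub>7\<close> would be negative definite as well, but it has an isotropic vector.\<close>

section \<open>Bases and dimensions of subspaces\<close>

text \<open>Independent subsets of \<open>W\<close> have at most \<open>dim\<close> elements, so a
  maximal one exists. Independence and span mean the same in \<open>vs W\<close> and in
  \<open>V\<close>, so it is a basis of \<open>W\<close>; phrasing the result in terms of
  \<open>V\<close> allows comparison with \<open>dim\<close>.\<close>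

lemma (in vectorspace) subspace_basis_exists:
  assumes fd: "fin_dim" and W: "subspace K W V"
  obtains B where "finite B" "B \<subseteq> W" "lin_indpt B" "span B = W"
    "vectorspace.dim K (vs W) = card B"
proof -
  have sub: "submodule K W V" and WV: "W \<subseteq> carrier V"
    using W unfolding subspace_def submodule_def by auto
  interpret W: vectorspace K "vs W" using W by (rule subspace_is_vs)
  have indpt: "W.lin_dep B = lin_dep B" if "B \<subseteq> W" for B
    using span_li_not_depend(2)[OF that sub] .
  have "\<exists>B. finite B \<and> maximal B (\<lambda>B. B \<subseteq> W \<and> lin_indpt B)"
  proof (rule maximal_exists)
    show "finite B \<and> card B \<le> dim" if "B \<subseteq> W \<and> lin_indpt B" for B
      using that li_le_dim[OF fd, of B] WV by auto
    show "{} \<subseteq> W \<and> lin_indpt {}" by (auto simp: lin_dep_def)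
  qed
  then obtain B where B: "finite B" "maximal B (\<lambda>B. B \<subseteq> W \<and> lin_indpt B)" by auto
  hence BW: "B \<subseteq> W" "lin_indpt B" by (auto simp: maximal_def)
  have "maximal B (\<lambda>B. B \<subseteq> carrier (vs W) \<and> W.lin_indpt B)"
    using B(2) indpt unfolding maximal_def by auto
  hence bas: "W.basis B" by (rule W.max_li_is_basis)
  hence "span B = W" 
    using span_li_not_depend(1)[OF BW(1) sub] by (simp add: W.basis_def)
  with that B(1) BW W.dim_basis[OF B(1) bas] show thesis by blast
qed

lemma (in vectorspace) subspace_dim_le:
  assumes "fin_dim" "subspace K W V"
  shows "vectorspace.dim K (vs W) \<le> dim"
proof -
  obtain B where "finite B" "B \<subseteq> W" "lin_indpt B" "vectorspace.dim K (vs W) = card B"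
    using subspace_basis_exists[OF assms] by metis
  moreover have "W \<subseteq> carrier V"
    using assms(2) unfolding subspace_def submodule_def by auto
  ultimately show ?thesis using li_le_dim(2)[OF assms(1), of B] by auto
qed

lemma (in vectorspace) subspace_dim_eq:
  assumes "fin_dim" "subspace K W V" "vectorspace.dim K (vs W) = dim"
  shows "W = carrier V"
proof -
  obtain B where B: "finite B" "B \<subseteq> W" "lin_indpt B" "span B = W"
      "vectorspace.dim K (vs W) = card B"
    using subspace_basis_exists[OF assms(1,2)] by metis
  moreover have "W \<subseteq> carrier V"
    using assms(2) unfolding subspace_def submodule_def by auto
  ultimately have "basis B" using dim_li_is_basis[OF assms(1), of B] assms(3) by auto
  with B show ?thesis by (simp add: basis_def)
qed

lemma (in vectorspace) dim_trivial_subspace: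
  assumes "fin_dim" "subspace K W V" "W \<subseteq> {\<zero>\<^bsub>V\<^esub>}"
  shows "vectorspace.dim K (vs W) = 0"
proof -
  obtain B where B: "finite B" "B \<subseteq> W" "lin_indpt B" "vectorspace.dim K (vs W) = card B"
    using subspace_basis_exists[OF assms(1,2)] by metis
  have "B \<subseteq> carrier V"
    using B(2) assms(2) unfolding subspace_def submodule_def by auto
  from vs_zero_lin_dep[OF this B(3)] have "B = {}" using B(2) assms(3) by auto
  with B show ?thesis by simp
qed

section \<open>Positive index of inertia\<close>

abbreviation positive_definite_on :: "complex mat \<Rightarrow> complex vec set \<Rightarrow> bool" where
  "positive_definite_on A W \<equiv> \<forall>v\<in>W. v \<noteq> 0\<^sub>v (dim_row A) \<longrightarrow> Re ((A *\<^sub>v v) \<bullet>c v) > 0"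

context
  fixes A :: "complex mat" and n :: nat
  assumes A: "dim_row A = n"
begin

interpretation vec_space "TYPE(complex)" n .

abbreviation positive_subspace_dims :: "nat set" where
  "positive_subspace_dims \<equiv>
     {vectorspace.dim class_ring (vs W) | W. subspace class_ring W V \<and> positive_definite_on A W}"

lemma positive_index_altdef: "positive_index A = Max positive_subspace_dims"
  by (simp add: positive_index_def A)

text \<open>\<open>Max\<close> is meaningful only for a finite nonempty set, which this lemma and
  the next one secure.\<close>

lemma positive_subspace_dims_finite: "finite positive_subspace_dims"
  by (rule finite_subset[of _ "{..n}"]) (use subspace_dim_le[OF fin_dim] dim_is_n in auto)

lemma positive_subspace_dims_nonempty: "positive_subspace_dims \<noteq> {}"
proof -
  have "subspace class_ring {0\<^sub>v n} V"
    using span_is_subspace[of "{}"] by (simp add: span_empty)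
  thus ?thesis by (auto simp: A intro!: exI[of _ "{0\<^sub>v n}"])
qed

lemma positive_index_attained:
  obtains W where "subspace class_ring W V" "positive_definite_on A W"
    "positive_index A = vectorspace.dim class_ring (vs W)"
  using Max_in[OF positive_subspace_dims_finite positive_subspace_dims_nonempty]
  unfolding positive_index_altdef by auto

lemma positive_index_le: "positive_index A \<le> n"
  using positive_index_attained subspace_dim_le[OF fin_dim] dim_is_n by metis

lemma positive_index_definite:
  assumes "positive_definite_on A (carrier_vec n)"
  shows "positive_index A = n"
proof -
  have "subspace class_ring (carrier_vec n) V"
    using span_is_subspace[OF unit_vecs_carrier] by (simp add: span_unit_vecs_is_carrier)
  moreover have "vectorspace.dim class_ring (vs (carrier_vec n)) = n"
    using dim_is_n by (simp add: module_vec_def)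
  ultimately have "n \<in> positive_subspace_dims"
    unfolding mem_Collect_eq using assms by (intro exI[of _ "carrier_vec n"]) simp
  hence "n \<le> positive_index A"
    unfolding positive_index_altdef using positive_subspace_dims_finite by (rule Max_ge[rotated])
  thus ?thesis using positive_index_le by simp
qed

text \<open>A subspace attaining the maximum has full dimension, so it is all of
  \<open>carrier_vec n\<close>.\<close>

lemma definite_if_positive_index_full:
  assumes "positive_index A = n"
  shows "positive_definite_on A (carrier_vec n)"
  using positive_index_attained subspace_dim_eq[OF fin_dim] dim_is_n assms cV by metis

lemma positive_index_eq_0:
  assumes "\<And>v. v \<in> carrier_vec n \<Longrightarrow> Re ((A *\<^sub>v v) \<bullet>c v) \<le> 0"
  shows "positive_index A = 0"
proof -
  obtain W where W: "subspace class_ring W V" "positive_definite_on A W"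
      "positive_index A = vectorspace.dim class_ring (vs W)"
    by (rule positive_index_attained)
  have "W \<subseteq> carrier_vec n" using W(1) unfolding subspace_def submodule_def by auto
  hence "W \<subseteq> {0\<^sub>v n}" using W(2) assms A by fastforce
  thus ?thesis using W dim_trivial_subspace[OF fin_dim] by simp
qed

end

section \<open>Integer-valued rational functions of linear growth\<close>

text \<open>Two terms within \<open>1/2\<close> of \<open>L\<close> differ by less than 1 and hence,
  being integers, agree.\<close>

lemma convergent_int_sequence_eventually_const:
  fixes s :: "nat \<Rightarrow> int"
  assumes "(\<lambda>k. real_of_int (s k)) \<longlonglongrightarrow> L"
  shows "\<forall>\<^sub>F k in sequentially. real_of_int (s k) = L"
proof -
  have "\<forall>\<^sub>F k in sequentially. dist (real_of_int (s k)) L < 1/2"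
    using assms by (rule tendstoD) simp
  then obtain K where K: "\<And>k. k \<ge> K \<Longrightarrow> \<bar>real_of_int (s k) - L\<bar> < 1/2"
    by (auto simp: eventually_at_top_linorder dist_real_def)
  have const: "s k = s K" if "k \<ge> K" for k
    using K[OF that] K[of K] by linarith
  hence ev: "\<forall>\<^sub>F k in sequentially. real_of_int (s k) = real_of_int (s K)"
    unfolding eventually_at_top_linorder by metis
  from assms tendsto_eventually[OF ev] have "L = real_of_int (s K)" by (rule LIMSEQ_unique)
  with ev show ?thesis by simp
qed

text \<open>A polynomial of degree at least 2 outgrows \<open>[:C, C:]\<close>, so the quotient
  \<open>[:C, C:] / p\<close> would tend to 0, whereas the hypothesis keeps its absolute value at 1
  or more wherever \<open>p\<close> does not vanish.\<close>

lemma poly_linear_growth_degree: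
  fixes p :: "real poly"
  assumes "\<And>k. \<bar>poly p (real k)\<bar> \<le> C * real (Suc k)"
  shows "degree p \<le> 1"
proof (rule ccontr)
  assume deg: "\<not> degree p \<le> 1"
  hence nz: "p \<noteq> 0" by auto
  have real: "filterlim real at_infinity sequentially"
    by (rule tendsto_of_nat)
  have "degree [:C, C:] < degree p" using deg by auto
  from filterlim_compose[OF poly_divide_tendsto_0_at_infinity[OF this] real]
  have "(\<lambda>k. poly [:C, C:] (real k) / poly p (real k)) \<longlonglongrightarrow> 0" .
  hence "\<forall>\<^sub>F k in sequentially. dist (poly [:C, C:] (real k) / poly p (real k)) 0 < 1"
    by (rule tendstoD) simp
  \<comment> \<open>Zeros of \<open>p\<close> must be excluded: since \<open>x / 0 = 0\<close>, the
    bound on the quotient says nothing there.\<close>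
  moreover have "\<forall>\<^sub>F k in sequentially. poly p (real k) \<noteq> 0"
  proof -
    have "finite {x. poly p x = 0}" using nz by (rule poly_roots_finite)
    hence "finite (real -` {x. poly p x = 0})" by (rule finite_vimageI) (simp add: inj_on_def)
    thus ?thesis by (simp add: vimage_def eventually_cofinite flip: cofinite_eq_sequentially)
  qed
  ultimately have "\<forall>\<^sub>F k::nat in sequentially. False"
  proof eventually_elim
    case (elim k)
    hence "\<bar>C * real (Suc k)\<bar> < \<bar>poly p (real k)\<bar>" by (simp add: divide_simps algebra_simps)
    thus ?case using assms[of k] by linarith
  qed
  thus False by simp
qed

text \<open>Division with remainder gives \<open>n / d = q + e\<close>, where
  \<open>e = r / d\<close> tends to 0. So \<open>q\<close> inherits the linear growth and has degree
  at most one; integrality of \<open>s\<close> then forces \<open>r = 0\<close>.\<close>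

lemma integer_valued_rational_function_linear:
  fixes n d :: "real poly" and s :: "nat \<Rightarrow> int"
  assumes d: "\<And>k. poly d (real k) \<noteq> 0"
    and s: "\<And>k. poly n (real k) / poly d (real k) = real_of_int (s k)"
    and growth: "\<And>k. \<bar>real_of_int (s k)\<bar> \<le> C * real (Suc k)"
  shows "\<exists>a b. n = d * [:a, b:]"
proof -
  define q r where "q = n div d" and "r = n mod d"
  define e where "e k = poly r (real k) / poly d (real k)" for k :: nat
  have d0: "d \<noteq> 0" using d[of 0] by auto
  have n: "n = d * q + r" by (simp add: q_def r_def)
  have sk: "real_of_int (s k) = poly q (real k) + e k" for k
    using s[of k] d[of k] by (simp add: n e_def add_divide_distrib)
  have e0: "e \<longlonglongrightarrow> 0"
  proof (cases "r = 0")
    case True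
    hence "e = (\<lambda>_. 0)" by (simp add: fun_eq_iff e_def)
    thus ?thesis by simp
  next
    case False
    hence "degree r < degree d" using d0 unfolding r_def by (simp add: degree_mod_less')
    from filterlim_compose[OF poly_divide_tendsto_0_at_infinity[OF this] tendsto_of_nat]
    show ?thesis unfolding e_def .
  qed
  then obtain B where B: "\<And>k. \<bar>e k\<bar> \<le> B"
    using convergent_imp_Bseq[of e] unfolding Bseq_def convergent_def by auto
  have "\<bar>poly q (real k)\<bar> \<le> (\<bar>C\<bar> + \<bar>B\<bar>) * real (Suc k)" for k
  proof -
    have "\<bar>poly q (real k)\<bar> \<le> C * real (Suc k) + \<bar>B\<bar> * 1"
      using growth[of k] B[of k] sk[of k] by linarith
    also have "\<dots> \<le> \<bar>C\<bar> * real (Suc k) + \<bar>B\<bar> * real (Suc k)"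
      by (intro add_mono mult_mono) auto
    finally show ?thesis by (simp add: algebra_simps)
  qed
  hence "degree q \<le> 1" by (rule poly_linear_growth_degree)
  define a b where "a = coeff q 0" and "b = coeff q 1"
  have q: "q = [:a, b:]"
    using \<open>degree q \<le> 1\<close>
    by (intro poly_eqI) (auto simp: a_def b_def coeff_pCons coeff_eq_0 split: nat.splits)
  \<comment> \<open>The first differences of \<open>s\<close> converge, hence are eventually equal to \<open>b\<close>; so \<open>e\<close> is eventually constant.\<close>
  have "(\<lambda>k. b + (e (Suc k) - e k)) \<longlonglongrightarrow> b + (0 - 0)"
    by (intro tendsto_intros e0 filterlim_compose[OF e0 filterlim_Suc])
  moreover have "b + (e (Suc k) - e k) = real_of_int (s (Suc k) - s k)" for k
    using sk[of k] sk[of "Suc k"] by (simp add: q algebra_simps)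
  ultimately have "(\<lambda>k. real_of_int (s (Suc k) - s k)) \<longlonglongrightarrow> b" by simp
  from convergent_int_sequence_eventually_const[OF this]
  have "\<forall>\<^sub>F k in sequentially. e (Suc k) = e k"
  proof eventually_elim
    case (elim k)
    thus ?case using sk[of k] sk[of "Suc k"] by (simp add: q algebra_simps)
  qed
  then obtain K where K: "\<And>k. k \<ge> K \<Longrightarrow> e (Suc k) = e k"
    by (auto simp: eventually_at_top_linorder)
  have const: "e k = e K" if "k \<ge> K" for k
    using that by (induction k rule: dec_induct) (simp_all add: K)
  hence "\<forall>\<^sub>F k in sequentially. e k = e K"
    unfolding eventually_at_top_linorder by metis
  hence "e \<longlonglongrightarrow> e K" by (rule tendsto_eventually)
  hence "e K = 0" using e0 by (rule LIMSEQ_unique)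
  hence "e k = 0" if "k \<ge> K" for k using const[OF that] by simp
  \<comment> \<open>Since \<open>d\<close> has no zero at a natural number, each zero of
    \<open>e\<close> is a zero of \<open>r\<close>, and infinitely many of them force
    \<open>r = 0\<close>.\<close>
  hence "real ` {K..} \<subseteq> {x. poly r x = 0}" using d by (auto simp: e_def)
  moreover have "infinite (real ` {K..})"
    by (simp add: finite_image_iff inj_on_def infinite_Ici)
  ultimately have "r = 0" using poly_roots_finite finite_subset by blast
  thus ?thesis using n q by auto
qed

text \<open>Fixing \<open>x\<close> leaves a univariate polynomial in \<open>y\<close>; for
  \<open>x = 3\<close> this gives access to the one-variable result.\<close>

lemma eval2_eq_poly_map_poly: "eval2 P x y = poly (map_poly (\<lambda>c. poly c x) P) y"
  by (induction P) (simp_all add: eval2_def map_poly_pCons)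

section \<open>The Seifert matrix of \<open>torus_knot 3 q\<close>\<close>

lemma length_torus_knot: "length (torus_knot p q) = q * (p - 1)"
  by (simp add: torus_knot_def length_concat sum_list_replicate)

lemma torus_knot_3_nth: "i < 2 * q \<Longrightarrow> torus_knot 3 q ! i = (if even i then 1 else 2)"
proof (induction q arbitrary: i)
  case (Suc q)
  have "torus_knot 3 (Suc q) = 1 # 2 # torus_knot 3 q"
    by (simp add: torus_knot_def upt_rec)
  thus ?case using Suc.IH[of "i - 2"] Suc.prems
    by (auto simp: nth_Cons split: nat.splits)
qed simp

lemma filter_eq_upt: "filter (\<lambda>b. b = c) [0..<n] = (if c < n then [c] else [])"
  by (induction n) auto

lemma concat_map_if: "concat (map (\<lambda>a. if P a then [f a] else []) xs) = map f (filter P xs)"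
  by (induction xs) auto

text \<open>The word alternates between the two generators, so the next band in a column comes two
  positions later. The last band of each column starts no loop, hence the bound
  \<open>2 * q - 2\<close>.\<close>

lemma seifert_loops_torus_knot_3:
  "seifert_loops (torus_knot 3 q) = map (\<lambda>a. (a, a + 2)) [0..<2 * q - 2]"
proof -
  let ?w = "torus_knot 3 q"
  have len: "length ?w = 2 * q" by (simp add: length_torus_knot)
  have next_band: "(a < b \<and> \<bar>?w ! a\<bar> = \<bar>?w ! b\<bar> \<and> (\<forall>c\<in>{a<..<b}. \<bar>?w ! c\<bar> \<noteq> \<bar>?w ! a\<bar>)) \<longleftrightarrow> b = a + 2"
    (is "?L \<longleftrightarrow> _") if "a < 2 * q" "b < 2 * q" for a b
  proof
    assume L: ?L
    hence "even a = even b"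
      using that by (auto simp: torus_knot_3_nth split: if_splits)
    \<comment> \<open>Position \<open>a + 2\<close> lies in the same column and would be a band in
      between.\<close>
    moreover have "\<not> a + 2 < b"
    proof
      assume "a + 2 < b"
      hence "\<bar>?w ! (a + 2)\<bar> \<noteq> \<bar>?w ! a\<bar>" using L by auto
      thus False using \<open>a + 2 < b\<close> that by (simp add: torus_knot_3_nth)
    qed
    moreover have "a < b" using L by simp
    ultimately show "b = a + 2" by presburger
  next
    assume b: "b = a + 2"
    have "\<bar>?w ! c\<bar> \<noteq> \<bar>?w ! a\<bar>" if "c \<in> {a<..<b}" for c
    proof -
      have "c = a + 1" using that b by auto
      thus ?thesis using b \<open>b < 2 * q\<close> by (simp add: torus_knot_3_nth)
    qed
    thus ?L using b that by (simp add: torus_knot_3_nth)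
  qed
  have "seifert_loops ?w = concat (map (\<lambda>a. map (Pair a) (filter (\<lambda>b. b = a + 2) [0..<2 * q])) [0..<2 * q])"
    unfolding seifert_loops_def List.product_concat_map filter_concat len map_map
  proof (intro arg_cong[where f = concat] map_cong refl)
    fix a assume "a \<in> set [0..<2 * q]"
    hence "filter ((\<lambda>(a, b). a < b \<and> \<bar>?w ! a\<bar> = \<bar>?w ! b\<bar> \<and> (\<forall>c\<in>{a<..<b}. \<bar>?w ! c\<bar> \<noteq> \<bar>?w ! a\<bar>))
        \<circ> Pair a) [0..<2 * q] = filter (\<lambda>b. b = a + 2) [0..<2 * q]"
      by (intro filter_cong refl) (simp only: o_def prod.case next_band set_upt atLeastLessThan_iff)
    thus "(filter (\<lambda>(a, b). a < b \<and> \<bar>?w ! a\<bar> = \<bar>?w ! b\<bar> \<and> (\<forall>c\<in>{a<..<b}. \<bar>?w ! c\<bar> \<noteq> \<bar>?w ! a\<bar>))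
        \<circ> (\<lambda>a. map (Pair a) [0..<2 * q])) a = map (Pair a) (filter (\<lambda>b. b = a + 2) [0..<2 * q])"
      by (simp only: o_apply filter_map)
  qed
  also have "\<dots> = concat (map (\<lambda>a. if a < 2 * q - 2 then [(a, a + 2)] else []) [0..<2 * q])"
    by (intro arg_cong[where f = concat] map_cong) (auto simp: filter_eq_upt)
  also have "\<dots> = map (\<lambda>a. (a, a + 2)) (filter (\<lambda>a. a < 2 * q - 2) [0..<2 * q])"
    by (rule concat_map_if)
  also have "filter (\<lambda>a. a < 2 * q - 2) [0..<2 * q] = [0..<2 * q - 2]"
    by (cases q) (auto intro!: filter_True)
  finally show ?thesis .
qed

lemma seifert_matrix_carrier [simp]:
  "seifert_matrix w \<in> carrier_mat (length (seifert_loops w)) (length (seifert_loops w))"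
  by (simp add: seifert_matrix_def)

lemma seifert_linking_far:
  assumes "i + 2 < j \<or> j + 2 < i"
  shows "seifert_linking w (i, i + 2) (j, j + 2) = 0"
proof -
  have "\<not> i = j" "\<not> i + 2 = j" "\<not> j + 2 = i"
    "\<not> (i < j \<and> j < i + 2 \<and> i + 2 < j + 2)" "\<not> (j < i \<and> i < j + 2 \<and> j + 2 < i + 2)"
    using assms by linarith+
  thus ?thesis
    by (simp only: seifert_linking_def prod.case prod.inject simp_thms if_False if_cancel)
qed

text \<open>Loops at distance two share a positive band, which counts in one order only. Loops at
  distance one interleave, and this counts only when the first loop lies in the second column, that
  is, for odd \<open>i\<close>.\<close>

lemma seifert_matrix_torus_knot_3:
  assumes "i < 2 * q - 2" "j < 2 * q - 2"
  shows "seifert_matrix (torus_knot 3 q) $$ (i, j) =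
    (if i = j then - 1
     else if j = i + 2 \<or> odd i \<and> j = i + 1 then 1
     else if odd i \<and> i = j + 1 then - 1
     else 0)"
proof -
  have "seifert_matrix (torus_knot 3 q) $$ (i, j) = seifert_linking (torus_knot 3 q) (i, i + 2) (j, j + 2)"
    using assms by (simp add: seifert_matrix_def seifert_loops_torus_knot_3)
  also have "\<dots> = (if i = j then - 1
     else if j = i + 2 \<or> odd i \<and> j = i + 1 then 1
     else if odd i \<and> i = j + 1 then - 1
     else 0)"
  proof -
    consider "i = j" | "j = i + 2" | "i = j + 2" | "j = i + 1" | "i = j + 1"
      | "i + 2 < j \<or> j + 2 < i" by linarith
    thus ?thesis
    proof cases
      case 6
      with seifert_linking_far[OF this, of "torus_knot 3 q"] show ?thesis by auto
    qed (use assms in \<open>simp_all add: seifert_linking_def torus_knot_3_nth\<close>)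
  qed
  finally show ?thesis .
qed

section \<open>From the hermitian form at \<open>- 1\<close> to a real quadratic form\<close>

text \<open>The quadratic form \<open>x\<^sup>T S x\<close>, which sees only the symmetric part of
  \<open>S\<close>. Functions in place of vectors let concrete instances expand into polynomials in
  \<open>x 0\<close>, \<open>x 1\<close> and so on.\<close>

definition seifert_form :: "int mat \<Rightarrow> (nat \<Rightarrow> real) \<Rightarrow> real" where
  "seifert_form S x = (\<Sum>i<dim_row S. \<Sum>j<dim_row S. of_int (S $$ (i, j)) * (x i * x j))"

text \<open>At \<open>z = - 1\<close> the matrix is \<open>2 (S + S\<^sup>T)\<close>, real and
  symmetric, so real and imaginary parts of \<open>v\<close> contribute separately; \<open>S\<close>
  and its transpose contribute equally, whence the factor 4.\<close>

lemma tristram_levine_form_minus_one: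
  assumes S: "S \<in> carrier_mat n n" and v: "v \<in> carrier_vec n"
  shows "Re ((tristram_levine_form S (- 1) *\<^sub>v v) \<bullet>c v) =
    4 * (seifert_form S (\<lambda>i. Re (v $ i)) + seifert_form S (\<lambda>i. Im (v $ i)))"
proof -
  define s where "s i j = real_of_int (S $$ (i, j))" for i j
  define g where "g i j = Re (v $ i) * Re (v $ j) + Im (v $ i) * Im (v $ j)" for i j
  have row: "(tristram_levine_form S (- 1) *\<^sub>v v) $ i = (\<Sum>j<n. of_real (2 * (s i j + s j i)) * v $ j)"
    if "i < n" for i
    using S v that
    by (simp add: scalar_prod_def tristram_levine_form_def atLeast0LessThan s_def distrib_left)
  have "(tristram_levine_form S (- 1) *\<^sub>v v) \<bullet>c v =
    (\<Sum>i<n. (\<Sum>j<n. of_real (2 * (s i j + s j i)) * v $ j) * cnj (v $ i))"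
    using v by (simp add: scalar_prod_def atLeast0LessThan row)
  also have "Re \<dots> = (\<Sum>i<n. \<Sum>j<n. 2 * (s i j + s j i) * g i j)"
    unfolding sum_distrib_right Re_sum
    by (intro sum.cong refl) (simp add: g_def algebra_simps)
  also have "\<dots> = 2 * (\<Sum>i<n. \<Sum>j<n. s i j * g i j) + 2 * (\<Sum>i<n. \<Sum>j<n. s j i * g i j)"
    unfolding sum_distrib_left sum.distrib[symmetric]
    by (intro sum.cong refl) (simp add: algebra_simps)
  \<comment> \<open>Here the symmetry of \<open>g\<close> enters.\<close>
  also have "(\<Sum>i<n. \<Sum>j<n. s j i * g i j) = (\<Sum>i<n. \<Sum>j<n. s i j * g i j)"
    by (subst sum.swap) (simp add: g_def algebra_simps)
  also have "(\<Sum>i<n. \<Sum>j<n. s i j * g i j) =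
      seifert_form S (\<lambda>i. Re (v $ i)) + seifert_form S (\<lambda>i. Im (v $ i))"
    unfolding seifert_form_def sum.distrib[symmetric] carrier_matD(1)[OF S]
    by (intro sum.cong refl) (simp add: s_def g_def algebra_simps)
  finally show ?thesis by simp
qed

context
  fixes S :: "int mat" and n :: nat
  assumes S: "S \<in> carrier_mat n n"
begin

private abbreviation A where "A \<equiv> tristram_levine_form S (- 1)"

private lemma dims: "dim_row A = n" "dim_col A = n" "dim_row (- A) = n"
  using S by (auto simp: tristram_levine_form_def)

lemma tristram_levine_signature_bound: "\<bar>hermitian_signature A\<bar> \<le> int n"
  using positive_index_le[OF dims(1)] positive_index_le[OF dims(3)]
  by (simp add: hermitian_signature_def)

private lemma uminus_form: "Re ((- A *\<^sub>v v) \<bullet>c v) = - Re ((A *\<^sub>v v) \<bullet>c v)" if "v \<in> carrier_vec n" for v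
proof -
  have "- A *\<^sub>v v = - (A *\<^sub>v v)" using that dims by (intro eq_vecI) auto
  thus ?thesis using that dims by simp
qed

text \<open>A nonzero complex vector has a nonzero real or imaginary part, and the other part
  contributes at most 0. So definiteness carries over from real to complex vectors, and the two
  indices are 0 and \<open>n\<close>.\<close>

lemma signature_negative_definite:
  assumes "\<And>x. \<exists>i<n. x i \<noteq> 0 \<Longrightarrow> seifert_form S x < 0"
  shows "hermitian_signature A = - int n"
proof -
  have le: "seifert_form S x \<le> 0" for x
  proof (cases "\<exists>i<n. x i \<noteq> 0")
    case False
    thus ?thesis using S by (auto simp: seifert_form_def intro!: sum_nonpos)
  qed (use assms in force)
  have "positive_index A = 0"
    by (rule positive_index_eq_0[OF dims(1)])
       (simp add: tristram_levine_form_minus_one[OF S] add_nonpos_nonpos le)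
  moreover have "positive_index (- A) = n"
  proof (rule positive_index_definite[OF dims(3)], intro ballI impI)
    fix v :: "complex vec"
    assume v: "v \<in> carrier_vec n" "v \<noteq> 0\<^sub>v (dim_row (- A))"
    then obtain i where i: "i < n" "v $ i \<noteq> 0" using dims by (metis carrier_vecD eq_vecI index_zero_vec)
    hence "Re (v $ i) \<noteq> 0 \<or> Im (v $ i) \<noteq> 0" by (simp add: complex_eq_iff)
    hence "seifert_form S (\<lambda>i. Re (v $ i)) < 0 \<or> seifert_form S (\<lambda>i. Im (v $ i)) < 0"
      using assms[of "\<lambda>i. Re (v $ i)"] assms[of "\<lambda>i. Im (v $ i)"] i(1) by auto
    hence "seifert_form S (\<lambda>i. Re (v $ i)) + seifert_form S (\<lambda>i. Im (v $ i)) < 0"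
      using le[of "\<lambda>i. Re (v $ i)"] le[of "\<lambda>i. Im (v $ i)"] by linarith
    thus "Re ((- A *\<^sub>v v) \<bullet>c v) > 0"
      by (simp add: uminus_form v tristram_levine_form_minus_one[OF S])
  qed
  ultimately show ?thesis by (simp add: hermitian_signature_def)
qed

text \<open>Signature \<open>- n\<close> forces index \<open>n\<close> for \<open>- A\<close>, hence
  definiteness on the whole space, which is then tested on a real vector.\<close>

lemma negative_definite_if_signature:
  assumes "hermitian_signature A = - int n" "\<exists>i<n. x i \<noteq> 0"
  shows "seifert_form S x < 0"
proof -
  define v where "v = vec n (\<lambda>i. complex_of_real (x i))"
  have v: "v \<in> carrier_vec n" by (simp add: v_def)
  have "positive_index (- A) = n"
    using assms(1) positive_index_le[OF dims(3)] by (simp add: hermitian_signature_def)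
  moreover have "v \<noteq> 0\<^sub>v n" using assms(2) by (auto simp: v_def vec_eq_iff)
  ultimately have "Re ((- A *\<^sub>v v) \<bullet>c v) > 0"
    using definite_if_positive_index_full[OF dims(3)] v dims by auto
  moreover have "seifert_form S (\<lambda>i. Re (v $ i)) = seifert_form S x" "seifert_form S (\<lambda>i. Im (v $ i)) = 0"
    using S by (auto simp: seifert_form_def v_def intro!: sum.cong sum.neutral)
  ultimately show ?thesis by (simp add: uminus_form v tristram_levine_form_minus_one[OF S])
qed

end

section \<open>Signatures of \<open>torus_knot 3 q\<close>: the bound and the cases 5 and 7\<close>

lemma torus_knot_3_carrier:
  "seifert_matrix (torus_knot 3 q) \<in> carrier_mat (2 * q - 2) (2 * q - 2)"
  using seifert_matrix_carrier[of "torus_knot 3 q"] by (simp add: seifert_loops_torus_knot_3)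

lemma dim_row_seifert_matrix_torus_knot_3: "dim_row (seifert_matrix (torus_knot 3 q)) = 2 * q - 2"
  using torus_knot_3_carrier by auto

lemma sigma_ord_bound: "\<bar>sigma_ord (torus_knot 3 q)\<bar> \<le> int (2 * q - 2)"
  unfolding sigma_ord_def tristram_levine_signature_def
  using torus_knot_3_carrier by (rule tristram_levine_signature_bound)

text \<open>The squares come from the \<open>LDL\<^sup>T\<close> decomposition of the symmetrised matrix.\<close>

lemma seifert_form_3_5:
  "seifert_form (seifert_matrix (torus_knot 3 5)) x =
    - ((x 0 + x 1 / 2 - x 2 / 2)\<^sup>2 + 3/4 * (x 1 - x 2 / 3 - 2/3 * x 3)\<^sup>2
       + 2/3 * (x 2 + x 3 / 2 - 3/4 * x 4)\<^sup>2 + 1/2 * (x 3 - x 4 / 2 - x 5)\<^sup>2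
       + 1/2 * (x 4 + x 5 / 2 - x 6)\<^sup>2 + 3/8 * (x 5 - 2/3 * x 6 - 4/3 * x 7)\<^sup>2
       + 1/3 * (x 6 + x 7 / 2)\<^sup>2 + 1/4 * (x 7)\<^sup>2)"
  by (simp add: seifert_form_def dim_row_seifert_matrix_torus_knot_3 seifert_matrix_torus_knot_3
      lessThan_nat_numeral lessThan_Suc power2_eq_square field_simps)

text \<open>The squares have positive coefficients and triangular arguments. If their sum is not
  positive, each of them vanishes, and back substitution from \<open>x 7\<close> down to
  \<open>x 0\<close> gives zero.\<close>

lemma sigma_ord_3_5: "sigma_ord (torus_knot 3 5) = - 8"
proof -
  have "seifert_form (seifert_matrix (torus_knot 3 5)) x < 0" if "\<exists>i<8. x i \<noteq> 0" for x
  proof (rule ccontr)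
    assume "\<not> ?thesis"
    hence "(x 0 + x 1 / 2 - x 2 / 2)\<^sup>2 + 3/4 * (x 1 - x 2 / 3 - 2/3 * x 3)\<^sup>2
       + 2/3 * (x 2 + x 3 / 2 - 3/4 * x 4)\<^sup>2 + 1/2 * (x 3 - x 4 / 2 - x 5)\<^sup>2
       + 1/2 * (x 4 + x 5 / 2 - x 6)\<^sup>2 + 3/8 * (x 5 - 2/3 * x 6 - 4/3 * x 7)\<^sup>2
       + 1/3 * (x 6 + x 7 / 2)\<^sup>2 + 1/4 * (x 7)\<^sup>2 \<le> 0"
      by (simp only: seifert_form_3_5)
    with zero_le_power2[of "x 0 + x 1 / 2 - x 2 / 2"]
      zero_le_power2[of "x 1 - x 2 / 3 - 2/3 * x 3"]
      zero_le_power2[of "x 2 + x 3 / 2 - 3/4 * x 4"]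
      zero_le_power2[of "x 3 - x 4 / 2 - x 5"]
      zero_le_power2[of "x 4 + x 5 / 2 - x 6"]
      zero_le_power2[of "x 5 - 2/3 * x 6 - 4/3 * x 7"]
      zero_le_power2[of "x 6 + x 7 / 2"]
      zero_le_power2[of "x 7"]
    have "(x 0 + x 1 / 2 - x 2 / 2)\<^sup>2 \<le> 0"
      "(x 1 - x 2 / 3 - 2/3 * x 3)\<^sup>2 \<le> 0"
      "(x 2 + x 3 / 2 - 3/4 * x 4)\<^sup>2 \<le> 0"
      "(x 3 - x 4 / 2 - x 5)\<^sup>2 \<le> 0"
      "(x 4 + x 5 / 2 - x 6)\<^sup>2 \<le> 0"
      "(x 5 - 2/3 * x 6 - 4/3 * x 7)\<^sup>2 \<le> 0"
      "(x 6 + x 7 / 2)\<^sup>2 \<le> 0"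
      "(x 7)\<^sup>2 \<le> 0"
      by linarith+
    hence "x 0 + x 1 / 2 - x 2 / 2 = 0"
      "x 1 - x 2 / 3 - 2/3 * x 3 = 0"
      "x 2 + x 3 / 2 - 3/4 * x 4 = 0"
      "x 3 - x 4 / 2 - x 5 = 0"
      "x 4 + x 5 / 2 - x 6 = 0"
      "x 5 - 2/3 * x 6 - 4/3 * x 7 = 0"
      "x 6 + x 7 / 2 = 0"
      "x 7 = 0"
      by simp_all
    hence "x i = 0" if "i \<in> {0, 1, 2, 3, 4, 5, 6, 7}" for i using that by auto
    moreover have "{..<8} = {0, 1, 2, 3, 4, 5, 6, 7::nat}" by (auto simp: lessThan_nat_numeral lessThan_Suc)
    ultimately show False using that by blast
  qed
  from signature_negative_definite[OF torus_knot_3_carrier[of 5], simplified, OF this]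
  show ?thesis by (simp add: sigma_ord_def tristram_levine_signature_def)
qed

text \<open>The matrix has size \<open>2 * 7 - 2 = 12\<close>, so the value \<open>- 12\<close>
  would make the form negative definite. Excluding this single value is enough for the final
  contradiction.\<close>

lemma sigma_ord_3_7: "sigma_ord (torus_knot 3 7) \<noteq> - 12"
proof
  assume sig: "sigma_ord (torus_knot 3 7) = - 12"
  \<comment> \<open>The first ten entries lie in the radical of the form of the link \<open>T\<^sub>3\<^sub>,\<^sub>6\<close>.\<close>
  define x :: "nat \<Rightarrow> real" where "x i = [-1, 1, -1, 2, 0, 2, 1, 1, 1, 0, 0, 0] ! i" for i
  have "seifert_form (seifert_matrix (torus_knot 3 7)) x < 0"
    by (rule negative_definite_if_signature[OF torus_knot_3_carrier])
       (use sig in \<open>auto simp: sigma_ord_def tristram_levine_signature_def x_def intro!: exI[of _ 0]\<close>)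
  moreover have "seifert_form (seifert_matrix (torus_knot 3 7)) x = 0"
    by (simp add: seifert_form_def dim_row_seifert_matrix_torus_knot_3 seifert_matrix_torus_knot_3
      lessThan_nat_numeral lessThan_Suc x_def)
  ultimately show False by simp
qed

section \<open>Contradiction along \<open>p = 3\<close>\<close>

theorem proposition5p1:
  shows "\<not> (\<exists>N D :: real poly poly. D \<noteq> 0 \<and>
    (\<forall>p q :: nat. 0 < p \<and> 0 < q \<and> odd p \<and> odd q \<and> coprime p q \<longrightarrow>
      ratfun_value N D (real p) (real q) (real_of_int (sigma_ord (torus_knot p q)))))"
proof
  assume "\<exists>N D :: real poly poly. D \<noteq> 0 \<and>
    (\<forall>p q :: nat. 0 < p \<and> 0 < q \<and> odd p \<and> odd q \<and> coprime p q \<longrightarrow>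
      ratfun_value N D (real p) (real q) (real_of_int (sigma_ord (torus_knot p q))))"
  then obtain N D :: "real poly poly" where ND: "\<And>p q. 0 < p \<Longrightarrow> 0 < q \<Longrightarrow> odd p \<Longrightarrow> odd q \<Longrightarrow> coprime p q \<Longrightarrow>
      ratfun_value N D (real p) (real q) (real_of_int (sigma_ord (torus_knot p q)))" by auto
  define n d where "n = map_poly (\<lambda>c. poly c 3) N" and "d = map_poly (\<lambda>c. poly c 3) D"
  have nd: "poly d (real q) \<noteq> 0" "poly n (real q) / poly d (real q) = real_of_int (sigma_ord (torus_knot 3 q))"
    if "odd q" "\<not> 3 dvd q" for q
  proof -
    have "prime (3::nat)" by simp
    hence "coprime 3 q" using that by (simp add: prime_imp_coprime)
    thus "poly d (real q) \<noteq> 0" "poly n (real q) / poly d (real q) = real_of_int (sigma_ord (torus_knot 3 q))"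
      using ND[of 3 q] that
      by (auto simp: ratfun_value_def n_def d_def eval2_eq_poly_map_poly intro: Nat.gr0I)
  qed
  \<comment> \<open>Each \<open>6 * k + 1\<close> is odd and prime to 3, hence admissible;
    substituting it is composition with \<open>[:1, 6:]\<close>.\<close>
  define s where "s k = sigma_ord (torus_knot 3 (6 * k + 1))" for k
  have "\<exists>a b. pcompose n [:1, 6:] = pcompose d [:1, 6:] * [:a, b:]"
  \<comment> \<open>At \<open>q = 6 * k + 1\<close> the matrix has size \<open>12 * k\<close>,
    whence \<open>C = 12\<close>.\<close>
  proof (rule integer_valued_rational_function_linear[where s = s and C = 12])
    fix k :: nat
    have q: "odd (6 * k + 1)" "\<not> 3 dvd (6 * k + 1)" by presburger+
    show "poly (pcompose d [:1, 6:]) (real k) \<noteq> 0"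
      "poly (pcompose n [:1, 6:]) (real k) / poly (pcompose d [:1, 6:]) (real k) = real_of_int (s k)"
      using nd[OF q] by (simp_all add: poly_pcompose s_def algebra_simps)
    show "\<bar>real_of_int (s k)\<bar> \<le> 12 * real (Suc k)"
      using sigma_ord_bound[of "6 * k + 1"] unfolding s_def by simp
  qed
  then obtain a b where ab: "pcompose n [:1, 6:] = pcompose d [:1, 6:] * [:a, b:]" by auto
  \<comment> \<open>The identity \<open>ab\<close> between polynomials holds at every real point, so
    \<open>k\<close> may be the fraction \<open>(q - 1) / 6\<close>. This reaches
    \<open>q = 5\<close>, which is outside the progression.\<close>
  have lin: "real_of_int (sigma_ord (torus_knot 3 q)) = a + b * ((real q - 1) / 6)"
    if "odd q" "\<not> 3 dvd q" for q
  proof -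
    have "poly [:1, 6:] ((real q - 1) / 6) = real q" by (simp add: field_simps)
    hence "poly n (real q) = poly d (real q) * (a + b * ((real q - 1) / 6))"
      using arg_cong[OF ab, of "\<lambda>p. poly p ((real q - 1) / 6)"]
      by (simp only: poly_pcompose poly_mult) (simp add: mult.commute)
    thus ?thesis using nd[OF that] by (metis nonzero_mult_div_cancel_left)
  qed
  \<comment> \<open>For \<open>q = 1\<close> the matrix is empty and the bound is 0.\<close>
  have "sigma_ord (torus_knot 3 1) = 0" using sigma_ord_bound[of 1] by simp
  hence "a = 0" using lin[of 1] by simp
  \<comment> \<open>Together with \<open>a = 0\<close> this gives \<open>b = - 12\<close>, which is
    the value predicted at \<open>q = 7\<close>, where \<open>(q - 1) / 6 = 1\<close>.\<close>
  moreover have "a + b * (2/3) = - 8" using lin[of 5] by (simp add: sigma_ord_3_5)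
  moreover have "real_of_int (sigma_ord (torus_knot 3 7)) = a + b" using lin[of 7] by simp
  ultimately have "real_of_int (sigma_ord (torus_knot 3 7)) = real_of_int (- 12)" by simp
  thus False using sigma_ord_3_7 by (simp only: of_int_eq_iff)
qed

end
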